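(* Let $X$ be a real Hausdorff topological vector space, $D\subseteq X$ a nonempty convex set, $n\in\mathbb{N}$, $k\in\{1,\dots,n\}$, and let $E=(E_1,\dots,E_n)$ be an $n$-tuple of generalized deviation functions on $D$. Then the generalized $E$-deviation mean $\mathscr{D}^E:D^n\to D$ is $\chi$-reducible with respect to any injective function $\chi:\{1,\dots,k\}\to\{1,\dots,n\}$. Furthermore, the $\chi$-reduction of $\mathscr{D}^E$ is uniquely determined, namely $$\mathscr{D}^E_\chi(x)=\mathscr{D}^{E_\chi}(x),\qquad x\in D^k,$$ where $E_\chi:=(E_{\chi(1)},\dots,E_{\chi(k)})$.
   Context: Notation: $\mathbb{N}_n:=\{1,\dots,n\}$; $\mathrm{conv}(H)$ denotes the convex hull of $H\subseteq X$. $D^*$ denotes the space of all continuous linear functionals defined on the linear hull of $D-D$. A mapping $E:D\times D\to D^*$ is a generalized deviation function on $D$ if (GE1) $E(u,u)=0$ for all $u\in D$; and (GE2) for every fixed $u\in D$, the function $v\mapsto -E(u,v)$ is continuous and strictly monotone on $D$, the latter meaning $\big(E(u,v)-E(u,w)\big)(v-w)<0$ for all $v,w\in D$ with $v\neq w$. For $m\in\mathbb{N}$, an $m$-tuple $E=(E_1,\dots,E_m)$ of generalized deviation functions on $D$ and $x\in D^m$, the generalized $E$-deviation mean $\mathscr{D}^E(x)$ is the vector $y\in\mathrm{conv}\{x_1,\dots,x_m\}$ satisfying $\big(E_1(x_1,y)+\dots+E_m(x_m,y)\big)(x_i-y)\leq 0$ for all $i\in\mathbb{N}_m$ (such $y$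 exists and is unique). A function $M:D^n\to X$ is a mean on $D$ if $M(x_1,\dots,x_n)\in\mathrm{conv}\{x_1,\dots,x_n\}$ for all $x\in D^n$. For a set $S$, $x\in S^k$, $y\in S$, the element $(x|\chi)(y)\in S^n$ is defined by $(x|\chi)(y)_i:=x_j$ if $i=\chi(j)$ for some $j\in\mathbb{N}_k$, and $(x|\chi)(y)_i:=y$ if $i\in\mathbb{N}_n\setminus\chi(\mathbb{N}_k)$. A mean $M:D^n\to X$ is $\chi$-reducible if there is a mean $K:D^k\to X$ (a $\chi$-reduction of $M$) such that, for all $x\in D^k$, $y=K(x)$ satisfies $M\big((x|\chi)(y)\big)=y$. If, for every $x\in D^k$, this equation has a unique solution $y\in\mathrm{conv}\{x_1,\dots,x_k\}$, that is, if $K$ is uniquely determined, then $M$ is called uniquely $\chi$-reducible, and its $\chi$-reduction $K$ is denoted $M_\chi$. *)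

theory Defs
  imports "HOL-Analysis.Analysis"
begin

class real_topological_vector = real_vector + topological_ab_group_add +
  assumes tendsto_scaleR_Pair:
    "LIM x (nhds a \<times>\<^sub>F nhds b). fst x *\<^sub>R snd x :> nhds (a *\<^sub>R b)"

instance real_normed_vector \<subseteq> real_topological_vector
proof
  fix a :: real and b :: 'a
  show "LIM x (nhds a \<times>\<^sub>F nhds b). fst x *\<^sub>R snd x :> nhds (a *\<^sub>R b)"
    by (intro tendsto_scaleR filterlim_fst filterlim_snd)
qed

text \<open>
  Conventions. An element of \<open>D\<^sup>n\<close> is an element of \<open>{1..n} \<rightarrow>\<^sub>E D\<close>, a function
  that is undefined outside \<open>{1..n}\<close>, so that equality of such functions is equality of
  tuples. In the same way a functional on the linear hull of \<open>D - D\<close> is a function that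
  is undefined outside that hull.
\<close>

definition diff_span :: "'a::real_vector set \<Rightarrow> 'a set" where
  "diff_span D = span {u - v |u v. u \<in> D \<and> v \<in> D}"

definition dual_on :: "'a::real_topological_vector set \<Rightarrow> ('a \<Rightarrow> real) set" where
  "dual_on D = {f \<in> extensional (diff_span D).
     (\<forall>h\<in>diff_span D. \<forall>h'\<in>diff_span D. f (h + h') = f h + f h') \<and>
     (\<forall>c. \<forall>h\<in>diff_span D. f (c *\<^sub>R h) = c * f h) \<and>
     continuous_on (diff_span D) f}"

text \<open>
  Continuity of \<open>v \<mapsto> - E u v\<close> is understood with respect to the topology of pointwise
  convergence (the weak-* topology) on \<open>dual_on D\<close>. As it is coarser than the other usual
  topologies on a dual space, continuity with respect to any of those implies this one.
\<close>

definition generalized_deviation ::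
    "'a::real_topological_vector set \<Rightarrow> ('a \<Rightarrow> 'a \<Rightarrow> 'a \<Rightarrow> real) \<Rightarrow> bool" where
  "generalized_deviation D E \<longleftrightarrow>
     (\<forall>u\<in>D. \<forall>v\<in>D. E u v \<in> dual_on D) \<and>
     (\<forall>u\<in>D. E u u = (\<lambda>h\<in>diff_span D. 0)) \<and>
     (\<forall>u\<in>D. (\<forall>h\<in>diff_span D. continuous_on D (\<lambda>v. - E u v h)) \<and>
             (\<forall>v\<in>D. \<forall>w\<in>D. v \<noteq> w \<longrightarrow> E u v (v - w) - E u w (v - w) < 0))"

definition deviation_mean ::
    "nat \<Rightarrow> (nat \<Rightarrow> 'a \<Rightarrow> 'a \<Rightarrow> 'a \<Rightarrow> real) \<Rightarrow> (nat \<Rightarrow> 'a) \<Rightarrow> 'a::real_vector" where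
  "deviation_mean m E x = (THE y. y \<in> convex hull (x ` {1..m}) \<and>
     (\<forall>i\<in>{1..m}. (\<Sum>j\<in>{1..m}. E j (x j) y (x i - y)) \<le> 0))"

definition is_mean :: "'a::real_vector set \<Rightarrow> nat \<Rightarrow> ((nat \<Rightarrow> 'a) \<Rightarrow> 'a) \<Rightarrow> bool" where
  "is_mean D n M \<longleftrightarrow> (\<forall>x \<in> {1..n} \<rightarrow>\<^sub>E D. M x \<in> convex hull (x ` {1..n}))"

text \<open>
  \<open>fill n k chi x y\<close> is the tuple written \<open>(x|chi)(y)\<close>; it is meaningful for \<open>chi\<close> injective on \<open>{1..k}\<close>.
\<close>

definition fill :: "nat \<Rightarrow> nat \<Rightarrow> (nat \<Rightarrow> nat) \<Rightarrow> (nat \<Rightarrow> 'a) \<Rightarrow> 'a \<Rightarrow> nat \<Rightarrow> 'a" where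
  "fill n k chi x y = (\<lambda>i\<in>{1..n}.
     if i \<in> chi ` {1..k} then x (the_inv_into {1..k} chi i) else y)"

definition is_reduction :: "'a::real_vector set \<Rightarrow> nat \<Rightarrow> nat \<Rightarrow> (nat \<Rightarrow> nat) \<Rightarrow>
    ((nat \<Rightarrow> 'a) \<Rightarrow> 'a) \<Rightarrow> ((nat \<Rightarrow> 'a) \<Rightarrow> 'a) \<Rightarrow> bool" where
  "is_reduction D n k chi M K \<longleftrightarrow>
     is_mean D k K \<and> (\<forall>x \<in> {1..k} \<rightarrow>\<^sub>E D. M (fill n k chi x (K x)) = K x)"

definition reducible :: "'a::real_vector set \<Rightarrow> nat \<Rightarrow> nat \<Rightarrow> (nat \<Rightarrow> nat) \<Rightarrow>
    ((nat \<Rightarrow> 'a) \<Rightarrow> 'a) \<Rightarrow> bool" where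
  "reducible D n k chi M \<longleftrightarrow> is_mean D n M \<and> (\<exists>K. is_reduction D n k chi M K)"

definition uniquely_reducible :: "'a::real_vector set \<Rightarrow> nat \<Rightarrow> nat \<Rightarrow> (nat \<Rightarrow> nat) \<Rightarrow>
    ((nat \<Rightarrow> 'a) \<Rightarrow> 'a) \<Rightarrow> bool" where
  "uniquely_reducible D n k chi M \<longleftrightarrow> reducible D n k chi M \<and>
     (\<forall>x \<in> {1..k} \<rightarrow>\<^sub>E D. \<exists>!y. y \<in> convex hull (x ` {1..k}) \<and> M (fill n k chi x y) = y)"

definition the_reduction :: "'a::real_vector set \<Rightarrow> nat \<Rightarrow> nat \<Rightarrow> (nat \<Rightarrow> nat) \<Rightarrow>
    ((nat \<Rightarrow> 'a) \<Rightarrow> 'a) \<Rightarrow> (nat \<Rightarrow> 'a) \<Rightarrow> 'a" where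
  "the_reduction D n k chi M =
     (THE K. K \<in> extensional ({1..k} \<rightarrow>\<^sub>E D) \<and> is_reduction D n k chi M K)"

end

theory Submission
  imports Defs
begin

text \<open>
  Put \<open>F(y) = E\<^sub>1(x\<^sub>1,y) + \<dots> + E\<^sub>m(x\<^sub>m,y)\<close>. The inequalities \<open>F(y)(x\<^sub>i - y) \<le> 0\<close> extend by
  linearity from the entries \<open>x\<^sub>i\<close> to all points of the compact convex set
  \<open>K = conv {x\<^sub>1,\<dots>,x\<^sub>m}\<close>, so the deviation mean is the solution in \<open>K\<close> of a variational
  inequality for the strictly monotone operator \<open>-F\<close>. Two solutions \<open>y \<noteq> z\<close> would give
  \<open>(F(y) - F(z))(y - z) \<ge> 0\<close>, against strict monotonicity; this is uniqueness.

  Existence is obtained from monotonicity by Minty's method, without a fixed point theorem.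
  The linearised problem asks for \<open>y \<in> K\<close> with \<open>F(z)(y - z) \<ge> 0\<close> for all \<open>z \<in> K\<close>. By
  compactness it is enough to treat finitely many \<open>z\<close> at a time. For these, a minimiser of the
  sum of the squared violations is a solution: otherwise the sum would decrease by moving towards
  the average of the points \<open>z\<close>, weighted by their violations, because monotonicity makes the
  weighted double sum of the terms \<open>F(z)(z' - z)\<close> nonnegative
  (\<open>finite_skew_system_solvable\<close>). Replacing \<open>z\<close>
  by \<open>y + s(w - y)\<close> and letting \<open>s\<close> tend to \<open>0\<close> leads back to the original inequality
  (\<open>variational_inequality_solvable\<close>).

  The statement on reductions then rests on (GE1). If \<open>y \<in> conv {x\<^sub>1,\<dots>,x\<^sub>k}\<close> and the tuple
  \<open>x\<close> is filled up with copies of \<open>y\<close>, neither the convex hull of the entries nor the sum \<open>F(y)\<close>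
  changes, since the new summands are \<open>E\<^sub>i(y,y) = 0\<close>. Hence \<open>y\<close> is the deviation mean of the
  filled tuple if and only if it is the deviation mean of \<open>x\<close> for the selected deviations
  (\<open>is_deviation_mean_fill_iff\<close>). Existence and uniqueness of the latter give the theorem.
\<close>

section \<open>Convex hulls of finite sets in topological vector spaces\<close>

lemma tendsto_scaleR_tvs:
  fixes g :: "'b \<Rightarrow> 'a::real_topological_vector"
  assumes "(f \<longlongrightarrow> a) F" and "(g \<longlongrightarrow> b) F"
  shows "((\<lambda>x. f x *\<^sub>R g x) \<longlongrightarrow> a *\<^sub>R b) F"
  using filterlim_compose[OF tendsto_scaleR_Pair filterlim_Pair[OF assms]] by simp

lemma continuous_on_scaleR_tvs:
  fixes g :: "'b::topological_space \<Rightarrow> 'a::real_topological_vector"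
  assumes "continuous_on S f" and "continuous_on S g"
  shows "continuous_on S (\<lambda>x. f x *\<^sub>R g x)"
  using assms unfolding continuous_on_def by (auto intro: tendsto_scaleR_tvs)

text \<open>
  Adding a point \<open>a\<close> replaces the hull \<open>C\<close> by the union of the segments from \<open>a\<close> to \<open>C\<close>,
  a continuous image of \<open>[0,1] \<times> C\<close>.
\<close>

lemma compact_convex_hull_finite_tvs:
  fixes S :: "'a::real_topological_vector set"
  assumes "finite S"
  shows "compact (convex hull S)"
  using assms
proof (induction S)
  case (insert a S)
  show ?case
  proof (cases "S = {}")
    case False
    have "convex hull (insert a S) =
        (\<lambda>p. (1 - fst p) *\<^sub>R a + fst p *\<^sub>R snd p) ` ({0..1} \<times> (convex hull S))"
      using False by (simp add: convex_hull_insert_alt image_def Bex_def) blast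
    moreover have "compact \<dots>"
      by (intro compact_continuous_image compact_Times compact_Icc insert.IH continuous_on_add
          continuous_on_scaleR_tvs continuous_intros)
    ultimately show ?thesis by simp
  qed simp
qed simp

section \<open>Monotone variational inequalities\<close>

text \<open>
  The function \<open>\<lambda>c. (max 0 (- c))\<^sup>2\<close> measures the violation of \<open>0 \<le> c\<close>; its derivative is
  \<open>- 2 * max 0 (- c)\<close>, and it exceeds its linear approximation by at most \<open>d\<^sup>2\<close>. Since it is
  decreasing, a lower bound \<open>c + d\<close> for the new value is enough, which is what concavity provides.
\<close>

lemma square_violation_le:
  fixes c d c' :: real
  assumes "c + d \<le> c'"
  shows "(max 0 (- c'))\<^sup>2 \<le> (max 0 (- c))\<^sup>2 - 2 * max 0 (- c) * d + d\<^sup>2"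
proof -
  have "(max 0 (- c'))\<^sup>2 \<le> (max 0 (- c) - d)\<^sup>2"
  proof (cases "c' < 0")
    case True
    then show ?thesis using assms by (intro power_mono) auto
  qed simp
  then show ?thesis by (simp add: power2_diff)
qed

text \<open>
  Let \<open>y\<close> minimise the sum of the squared violations and let \<open>r z\<close> be the violation at \<open>y\<close>.
  Minimality gives \<open>(\<Sum>z\<in>Z. r z * b z w) \<le> - (\<Sum>z\<in>Z. (r z)\<^sup>2)\<close> for every \<open>w \<in> K\<close>. At the
  average \<open>w\<close> of the points \<open>z\<close> with weights \<open>r z\<close> the left hand side is nonnegative by
  concavity and the sign condition on \<open>b z z' + b z' z\<close>, so that all violations vanish.
\<close>

lemma finite_skew_system_solvable:
  fixes K Z :: "'a::{real_vector, topological_space} set" and b :: "'a \<Rightarrow> 'a \<Rightarrow> real"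
  assumes K: "compact K" "convex K" "K \<noteq> {}"
    and Z: "finite Z" "Z \<subseteq> K"
    and concave: "\<And>z. z \<in> Z \<Longrightarrow> concave_on K (b z)"
    and cont: "\<And>z. z \<in> Z \<Longrightarrow> continuous_on K (b z)"
    and skew: "\<And>z z'. z \<in> Z \<Longrightarrow> z' \<in> Z \<Longrightarrow> 0 \<le> b z z' + b z' z"
  obtains y where "y \<in> K" and "\<And>z. z \<in> Z \<Longrightarrow> 0 \<le> b z y"
proof -
  define \<phi> where "\<phi> y = (\<Sum>z\<in>Z. (max 0 (- b z y))\<^sup>2)" for y
  have "continuous_on K \<phi>"
    unfolding \<phi>_def by (intro continuous_intros cont)
  then obtain y where y: "y \<in> K" and min: "\<And>w. w \<in> K \<Longrightarrow> \<phi> y \<le> \<phi> w"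
    using continuous_attains_inf[OF K(1,3)] by blast
  define r where "r z = max 0 (- b z y)" for z
  define R where "R = (\<Sum>z\<in>Z. r z)"
  have r0: "0 \<le> r z" for z by (simp add: r_def)
  have r_b: "r z * b z y = - (r z)\<^sup>2" for z
    by (auto simp: r_def max_def power2_eq_square)
  have descent: "(\<Sum>z\<in>Z. r z * b z w) \<le> - (\<Sum>z\<in>Z. (r z)\<^sup>2)" if w: "w \<in> K" for w
  proof -
    define d where "d z = b z w - b z y" for z
    define A where "A = (\<Sum>z\<in>Z. r z * d z)"
    define B where "B = (\<Sum>z\<in>Z. (d z)\<^sup>2)"
    have bound: "2 * A \<le> s * B" if s: "0 < s" "s \<le> 1" for s
    proof -
      let ?y = "(1 - s) *\<^sub>R y + s *\<^sub>R w"
      have "?y \<in> K" using K(2) y w s by (auto simp: convex_def)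
      then have "\<phi> y \<le> \<phi> ?y" by (rule min)
      also have "\<dots> \<le> (\<Sum>z\<in>Z. (r z)\<^sup>2 - 2 * r z * (s * d z) + (s * d z)\<^sup>2)"
        unfolding \<phi>_def
      proof (rule sum_mono)
        fix z assume "z \<in> Z"
        then have "(1 - s) * b z y + s * b z w \<le> b z ?y"
          using concave[of z] y w s by (auto simp: concave_on_iff)
        then have "b z y + s * d z \<le> b z ?y" by (simp add: d_def algebra_simps)
        then show "(max 0 (- b z ?y))\<^sup>2 \<le> (r z)\<^sup>2 - 2 * r z * (s * d z) + (s * d z)\<^sup>2"
          unfolding r_def by (rule square_violation_le)
      qed
      also have "\<dots> = \<phi> y - s * (2 * A) + s * (s * B)"
        by (simp add: \<phi>_def r_def A_def B_def sum.distrib sum_subtractf sum_distrib_left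
            power2_eq_square algebra_simps)
      finally have "s * (2 * A) \<le> s * (s * B)" by simp
      then show ?thesis using s by simp
    qed
    have "((\<lambda>s. s * B) \<longlongrightarrow> 0 * B) (at_right 0)" by (intro tendsto_intros)
    moreover have "eventually (\<lambda>s. 2 * A \<le> s * B) (at_right 0)"
      using eventually_at_right_real[of 0 1] by (auto elim!: eventually_mono intro: bound)
    ultimately have "2 * A \<le> 0 * B"
      by (intro tendsto_lowerbound) auto
    then have "A \<le> 0" by simp
    moreover have "A = (\<Sum>z\<in>Z. r z * b z w) + (\<Sum>z\<in>Z. (r z)\<^sup>2)"
      by (simp add: A_def d_def right_diff_distrib r_b sum.distrib)
    ultimately show ?thesis by simp
  qed
  have "R = 0"
  proof (rule ccontr)
    assume "R \<noteq> 0"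
    then have R: "0 < R" using r0 by (simp add: R_def sum_nonneg order_less_le)
    then have ne: "Z \<noteq> {}" by (auto simp: R_def)
    define w where "w = (\<Sum>z\<in>Z. (r z / R) *\<^sub>R z)"
    have weights: "(\<Sum>z\<in>Z. r z / R) = 1" "\<And>z. 0 \<le> r z / R"
      using R r0 by (simp_all add: R_def flip: sum_divide_distrib)
    have wK: "w \<in> K"
      unfolding w_def using K(2) Z weights by (intro convex_sum) auto
    define T where "T = (\<Sum>z\<in>Z. \<Sum>z'\<in>Z. r z * r z' * b z z')"
    have T_swap: "T = (\<Sum>z\<in>Z. \<Sum>z'\<in>Z. r z * r z' * b z' z)"
      unfolding T_def by (subst sum.swap) (simp add: mult.commute)
    have "2 * T = (\<Sum>z\<in>Z. \<Sum>z'\<in>Z. r z * r z' * (b z z' + b z' z))"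
      using T_def T_swap by (simp add: sum.distrib algebra_simps)
    also have "\<dots> \<ge> 0" by (intro sum_nonneg mult_nonneg_nonneg r0 skew)
    finally have "0 \<le> T" by simp
    also have "T = R * (\<Sum>z\<in>Z. r z * (\<Sum>z'\<in>Z. r z' / R * b z z'))"
      using R by (simp add: T_def sum_distrib_left mult.assoc)
    also have "\<dots> \<le> R * (\<Sum>z\<in>Z. r z * b z w)"
    proof (intro mult_left_mono sum_mono r0)
      fix z assume "z \<in> Z"
      then show "(\<Sum>z'\<in>Z. r z' / R * b z z') \<le> b z w"
        unfolding w_def using Z weights ne concave[of z]
        by (intro concave_on_sum[where C = K]) auto
    qed (use R in simp)
    finally have "0 \<le> (\<Sum>z\<in>Z. r z * b z w)"
      using R by (simp add: zero_le_mult_iff)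
    then have "(\<Sum>z\<in>Z. (r z)\<^sup>2) \<le> 0" using descent[OF wK] by simp
    then have "(\<Sum>z\<in>Z. (r z)\<^sup>2) = 0" by (simp add: order_antisym sum_nonneg)
    then have "\<forall>z\<in>Z. r z = 0" using Z(1) by (simp add: sum_nonneg_eq_0_iff)
    then show False using R by (simp add: R_def)
  qed
  then have "\<forall>z\<in>Z. r z = 0"
    using Z(1) r0 by (simp add: R_def sum_nonneg_eq_0_iff)
  then have "\<And>z. z \<in> Z \<Longrightarrow> 0 \<le> b z y" by (force simp: r_def max_def split: if_splits)
  then show ?thesis using y that by blast
qed

definition linear_functional_on :: "'a::real_vector set \<Rightarrow> ('a \<Rightarrow> real) \<Rightarrow> bool" where
  "linear_functional_on V f \<longleftrightarrow>
     (\<forall>h\<in>V. \<forall>h'\<in>V. f (h + h') = f h + f h') \<and> (\<forall>c. \<forall>h\<in>V. f (c *\<^sub>R h) = c * f h)"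

lemma linear_functional_on_zero: "linear_functional_on V f \<Longrightarrow> h \<in> V \<Longrightarrow> f 0 = 0"
  unfolding linear_functional_on_def by (metis mult_zero_left scaleR_zero_left)

lemma linear_functional_on_minus: "linear_functional_on V f \<Longrightarrow> h \<in> V \<Longrightarrow> f (- h) = - f h"
  unfolding linear_functional_on_def by (metis mult_minus1 scaleR_minus1_left)

text \<open>
  This is the Hartman--Stampacchia theorem for the monotone operator \<open>-F\<close>. The inequality
  \<open>F y (w - y) \<le> 0\<close> depends on \<open>y\<close> through \<open>F y\<close> as well. In Minty's form \<open>0 \<le> F z (y - z)\<close>
  the left hand side is affine and continuous in \<open>y\<close>, so each \<open>z\<close> gives a closed condition on
  \<open>y\<close> and compactness reduces to finitely many of them. Continuity of \<open>z \<mapsto> F z h\<close> along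
  segments leading to \<open>y\<close> recovers the original inequality.
\<close>

lemma variational_inequality_solvable:
  fixes K V :: "'a::{real_topological_vector, t2_space} set" and F :: "'a \<Rightarrow> 'a \<Rightarrow> real"
  assumes K: "compact K" "convex K" "K \<noteq> {}"
    and V: "\<And>u v. u \<in> K \<Longrightarrow> v \<in> K \<Longrightarrow> u - v \<in> V"
    and lin: "\<And>z. z \<in> K \<Longrightarrow> linear_functional_on V (F z)"
    and cont_dual: "\<And>z. z \<in> K \<Longrightarrow> continuous_on V (F z)"
    and cont: "\<And>h. h \<in> V \<Longrightarrow> continuous_on K (\<lambda>z. F z h)"
    and mono: "\<And>v w. v \<in> K \<Longrightarrow> w \<in> K \<Longrightarrow> F v (v - w) - F w (v - w) \<le> 0"
  obtains y where "y \<in> K" and "\<And>w. w \<in> K \<Longrightarrow> F y (w - y) \<le> 0"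
proof -
  define b where "b z y = F z (y - z)" for z y
  have b_cont: "continuous_on K (b z)" if "z \<in> K" for z
    unfolding b_def using V that
    by (intro continuous_on_compose2[OF cont_dual[OF that]] continuous_on_diff
        continuous_on_id continuous_on_const) auto
  have b_concave: "concave_on K (b z)" if z: "z \<in> K" for z
    unfolding concave_on_iff
  proof (intro conjI K ballI allI impI)
    fix v w and s t :: real
    assume *: "v \<in> K" "w \<in> K" "0 \<le> s" "0 \<le> t" "s + t = 1"
    have eq: "s *\<^sub>R v + t *\<^sub>R w - z = s *\<^sub>R (v - z) + t *\<^sub>R (w - z)"
      using *(5) by (simp add: algebra_simps flip: scaleR_add_left)
    have mem: "p *\<^sub>R (u - z) \<in> V" if "u \<in> K" "0 \<le> p" "p \<le> 1" for u p
    proof -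
      have "(1 - p) *\<^sub>R z + p *\<^sub>R u \<in> K"
        using K(2) z that by (auto simp: convex_def)
      from V[OF this z] show ?thesis by (simp add: algebra_simps)
    qed
    have "F z (s *\<^sub>R (v - z) + t *\<^sub>R (w - z)) = F z (s *\<^sub>R (v - z)) + F z (t *\<^sub>R (w - z))"
      using lin[OF z] mem * by (simp add: linear_functional_on_def)
    also have "\<dots> = s * F z (v - z) + t * F z (w - z)"
      using lin[OF z] V[OF _ z] * by (simp add: linear_functional_on_def)
    finally show "s * b z v + t * b z w \<le> b z (s *\<^sub>R v + t *\<^sub>R w)"
      by (simp add: b_def eq)
  qed
  have b_skew: "0 \<le> b z z' + b z' z" if "z \<in> K" "z' \<in> K" for z z'
    using mono[OF that] linear_functional_on_minus[OF lin[OF that(1)] V[OF that]]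
    by (simp add: b_def)
  have "K \<inter> (\<Inter>z\<in>K. K \<inter> b z -` {0..}) \<noteq> {}"
  proof (rule compact_imp_fip_image[OF K(1)])
    show "closed (K \<inter> b z -` {0..})" if "z \<in> K" for z
      using b_cont[OF that] K(1) by (intro continuous_closed_preimage closed_atLeast) (auto intro: compact_imp_closed)
  next
    fix Z assume "finite Z" "Z \<subseteq> K"
    then obtain y where "y \<in> K" "\<And>z. z \<in> Z \<Longrightarrow> 0 \<le> b z y"
      using finite_skew_system_solvable[OF K, of Z b] b_concave b_cont b_skew
      by (metis subsetD)
    then show "K \<inter> (\<Inter>z\<in>Z. K \<inter> b z -` {0..}) \<noteq> {}" by auto
  qed
  then obtain y where y: "y \<in> K" and "\<And>z. z \<in> K \<Longrightarrow> y \<in> b z -` {0..}" by blast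
  then have minty: "\<And>z. z \<in> K \<Longrightarrow> 0 \<le> F z (y - z)" by (simp add: b_def)
  have "F y (w - y) \<le> 0" if w: "w \<in> K" for w
  proof -
    define z where "z s = (1 - s) *\<^sub>R y + s *\<^sub>R w" for s :: real
    have zK: "z s \<in> K" if "0 < s" "s < 1" for s
      using K(2) y w that by (auto simp: convex_def z_def)
    have "F (z s) (w - y) \<le> 0" if s: "0 < s" "s < 1" for s
    proof -
      have "y - z s = (- s) *\<^sub>R (w - y)" by (simp add: z_def algebra_simps)
      then have "F (z s) (y - z s) = - s * F (z s) (w - y)"
        using lin[OF zK[OF s]] V[OF w y] by (simp only: linear_functional_on_def)
      then show ?thesis using minty[OF zK[OF s]] s by (simp add: mult_le_0_iff)
    qed
    then have ev: "\<forall>\<^sub>F s in at_right 0. F (z s) (w - y) \<le> 0" "\<forall>\<^sub>F s in at_right 0. z s \<in> K"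
      using eventually_at_right_real[of 0 1] zK by (auto elim!: eventually_mono)
    have "(z \<longlongrightarrow> (1 - 0) *\<^sub>R y + 0 *\<^sub>R w) (at_right 0)"
      unfolding z_def by (intro tendsto_add tendsto_scaleR_tvs tendsto_intros)
    then have "(z \<longlongrightarrow> y) (at_right 0)" by simp
    then have "((\<lambda>s. F (z s) (w - y)) \<longlongrightarrow> F y (w - y)) (at_right 0)"
      using continuous_on_tendsto_compose[OF cont[OF V[OF w y]]] y ev(2) by blast
    then show ?thesis using ev(1) by (intro tendsto_upperbound) auto
  qed
  with y that show ?thesis by blast
qed

section \<open>Existence and uniqueness of the deviation mean\<close>

definition is_deviation_mean ::
    "nat \<Rightarrow> (nat \<Rightarrow> 'a \<Rightarrow> 'a \<Rightarrow> 'a \<Rightarrow> real) \<Rightarrow> (nat \<Rightarrow> 'a) \<Rightarrow> 'a::real_vector \<Rightarrow> bool" where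
  "is_deviation_mean m E x y \<longleftrightarrow> y \<in> convex hull (x ` {1..m}) \<and>
     (\<forall>i\<in>{1..m}. (\<Sum>j\<in>{1..m}. E j (x j) y (x i - y)) \<le> 0)"

lemma diff_in_diff_span: "u \<in> D \<Longrightarrow> v \<in> D \<Longrightarrow> u - v \<in> diff_span D"
  unfolding diff_span_def by (rule span_base) blast

lemma generalized_deviation_in_dual:
  "generalized_deviation D E \<Longrightarrow> u \<in> D \<Longrightarrow> v \<in> D \<Longrightarrow> E u v \<in> dual_on D"
  by (simp add: generalized_deviation_def)

lemma sum_deviations_linear:
  fixes m :: nat
  assumes "\<forall>j\<in>{1..m}. generalized_deviation D (E j)"
    and "x \<in> {1..m} \<rightarrow> D" and "y \<in> D"
  shows "linear_functional_on (diff_span D) (\<lambda>h. \<Sum>j\<in>{1..m}. E j (x j) y h)"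
proof -
  have "E j (x j) y \<in> dual_on D" if "j \<in> {1..m}" for j
    using assms that by (intro generalized_deviation_in_dual) auto
  then show ?thesis
    by (auto simp: linear_functional_on_def dual_on_def sum_distrib_left
        simp flip: sum.distrib intro!: sum.cong)
qed

lemma sum_deviations_strict_mono:
  fixes m :: nat
  assumes E: "\<forall>j\<in>{1..m}. generalized_deviation D (E j)"
    and x: "x \<in> {1..m} \<rightarrow> D"
    and "1 \<le> m" "v \<in> D" "w \<in> D" "v \<noteq> w"
  shows "(\<Sum>j\<in>{1..m}. E j (x j) v (v - w)) < (\<Sum>j\<in>{1..m}. E j (x j) w (v - w))"
proof (rule sum_strict_mono)
  fix j assume j: "j \<in> {1..m}"
  then have "generalized_deviation D (E j)" "x j \<in> D" using E x by auto
  then show "E j (x j) v (v - w) < E j (x j) w (v - w)"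
    using assms(4-6) by (simp add: generalized_deviation_def)
qed (use \<open>1 \<le> m\<close> in simp_all)

lemma is_deviation_mean_exists:
  fixes D :: "'a::{real_topological_vector, t2_space} set"
  assumes E: "\<forall>j\<in>{1..m}. generalized_deviation D (E j)"
    and x: "x \<in> {1..m} \<rightarrow> D" and "convex D" and m: "1 \<le> m"
  shows "\<exists>y. is_deviation_mean m E x y"
proof -
  let ?K = "convex hull (x ` {1..m})" and ?F = "\<lambda>y h. \<Sum>j\<in>{1..m}. E j (x j) y h"
  have KD: "?K \<subseteq> D" using x \<open>convex D\<close> by (intro hull_minimal) auto
  obtain y where y: "y \<in> ?K" "\<And>w. w \<in> ?K \<Longrightarrow> ?F y (w - y) \<le> 0"
  proof (rule variational_inequality_solvable[of ?K "diff_span D" ?F])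
    show "compact ?K" by (intro compact_convex_hull_finite_tvs) simp
    show "?K \<noteq> {}" using m by simp
    show "u - v \<in> diff_span D" if "u \<in> ?K" "v \<in> ?K" for u v
      using that KD by (intro diff_in_diff_span) auto
    show "linear_functional_on (diff_span D) (?F z)" if "z \<in> ?K" for z
      using that KD E x by (intro sum_deviations_linear) auto
    show "continuous_on (diff_span D) (?F z)" if "z \<in> ?K" for z
    proof (intro continuous_on_sum)
      fix j assume "j \<in> {1..m}"
      then have "E j (x j) z \<in> dual_on D"
        using E x that KD by (intro generalized_deviation_in_dual) auto
      then show "continuous_on (diff_span D) (E j (x j) z)" by (simp add: dual_on_def)
    qed
    show "continuous_on ?K (\<lambda>z. ?F z h)" if "h \<in> diff_span D" for h
    proof (intro continuous_on_sum)
      fix j assume "j \<in> {1..m}"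
      then have "generalized_deviation D (E j)" "x j \<in> D" using E x by auto
      then have "continuous_on D (\<lambda>v. - E j (x j) v h)"
        using that by (simp add: generalized_deviation_def)
      from continuous_on_minus[OF continuous_on_subset[OF this KD]]
      show "continuous_on ?K (\<lambda>v. E j (x j) v h)" by simp
    qed
    show "?F v (v - w) - ?F w (v - w) \<le> 0" if "v \<in> ?K" "w \<in> ?K" for v w
    proof (cases "v = w")
      case False
      have "?F v (v - w) < ?F w (v - w)"
        using that KD False by (intro sum_deviations_strict_mono[OF E x m]) auto
      then show ?thesis by simp
    qed simp
  qed (use that in simp_all)
  then have "is_deviation_mean m E x y"
    by (auto simp: is_deviation_mean_def hull_inc)
  then show ?thesis ..
qed

text \<open>
  For fixed \<open>y\<close> the left hand side is affine in \<open>w\<close>, so the inequality spreads from the entries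
  of the tuple to their convex hull.
\<close>

lemma is_deviation_mean_on_hull:
  assumes E: "\<forall>j\<in>{1..m}. generalized_deviation D (E j)"
    and x: "x \<in> {1..m} \<rightarrow> D" and "convex D"
    and y: "is_deviation_mean m E x y" and w: "w \<in> convex hull (x ` {1..m})"
  shows "(\<Sum>j\<in>{1..m}. E j (x j) y (w - y)) \<le> 0"
proof -
  let ?f = "\<lambda>h. \<Sum>j\<in>{1..m}. E j (x j) y h"
  have KD: "convex hull (x ` {1..m}) \<subseteq> D" using x \<open>convex D\<close> by (intro hull_minimal) auto
  then have yD: "y \<in> D" using y by (auto simp: is_deviation_mean_def)
  have lin: "linear_functional_on (diff_span D) ?f"
    by (rule sum_deviations_linear[OF E x yD])
  have "convex {w \<in> D. ?f (w - y) \<le> 0}"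
  proof (rule convexI)
    fix v w and s t :: real
    assume *: "v \<in> {w \<in> D. ?f (w - y) \<le> 0}" "w \<in> {w \<in> D. ?f (w - y) \<le> 0}"
      "0 \<le> s" "0 \<le> t" "s + t = 1"
    have V: "v - y \<in> diff_span D" "w - y \<in> diff_span D"
      using * yD by (auto intro: diff_in_diff_span)
    then have V': "s *\<^sub>R (v - y) \<in> diff_span D" "t *\<^sub>R (w - y) \<in> diff_span D"
      unfolding diff_span_def by (auto intro: span_scale)
    have "s *\<^sub>R v + t *\<^sub>R w - y = s *\<^sub>R (v - y) + t *\<^sub>R (w - y)"
      using *(5) by (simp add: algebra_simps flip: scaleR_add_left)
    then have "?f (s *\<^sub>R v + t *\<^sub>R w - y) = s * ?f (v - y) + t * ?f (w - y)"
      using lin V V' unfolding linear_functional_on_def by simp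
    also have "\<dots> \<le> 0"
      using * by (intro add_nonpos_nonpos mult_nonneg_nonpos) auto
    finally show "s *\<^sub>R v + t *\<^sub>R w \<in> {w \<in> D. ?f (w - y) \<le> 0}"
      using * \<open>convex D\<close> by (auto simp: convex_def)
  qed
  then have "convex hull (x ` {1..m}) \<subseteq> {w \<in> D. ?f (w - y) \<le> 0}"
    using x y by (intro hull_minimal) (auto simp: is_deviation_mean_def)
  then show ?thesis using w by auto
qed

lemma is_deviation_mean_unique:
  assumes E: "\<forall>j\<in>{1..m}. generalized_deviation D (E j)"
    and x: "x \<in> {1..m} \<rightarrow> D" and D: "convex D" and m: "1 \<le> m"
    and y: "is_deviation_mean m E x y" and z: "is_deviation_mean m E x z"
  shows "y = z"
proof (rule ccontr)
  assume "y \<noteq> z"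
  let ?F = "\<lambda>y h. \<Sum>j\<in>{1..m}. E j (x j) y h"
  have yK: "y \<in> convex hull (x ` {1..m})" and zK: "z \<in> convex hull (x ` {1..m})"
    using y z by (auto simp: is_deviation_mean_def)
  moreover have "convex hull (x ` {1..m}) \<subseteq> D" using x D by (intro hull_minimal) auto
  ultimately have yz: "y \<in> D" "z \<in> D" by auto
  have "?F y (y - z) < ?F z (y - z)"
    by (rule sum_deviations_strict_mono[OF E x m yz \<open>y \<noteq> z\<close>])
  moreover have "?F z (y - z) \<le> 0" "?F y (z - y) \<le> 0"
    by (rule is_deviation_mean_on_hull[OF E x D z yK] is_deviation_mean_on_hull[OF E x D y zK])+
  moreover have "?F y (- (y - z)) = - ?F y (y - z)"
    using yz by (intro linear_functional_on_minus[OF sum_deviations_linear[OF E x]]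
        diff_in_diff_span)
  ultimately show False by simp
qed

lemma deviation_mean_eq_iff:
  fixes D :: "'a::{real_topological_vector, t2_space} set"
  assumes "\<forall>j\<in>{1..m}. generalized_deviation D (E j)"
    and "x \<in> {1..m} \<rightarrow> D" and "convex D" and "1 \<le> m"
  shows "deviation_mean m E x = y \<longleftrightarrow> is_deviation_mean m E x y"
proof -
  have "\<exists>!y. is_deviation_mean m E x y"
    using is_deviation_mean_exists[OF assms] is_deviation_mean_unique[OF assms] by blast
  moreover have "deviation_mean m E x = (THE y. is_deviation_mean m E x y)"
    by (simp add: deviation_mean_def is_deviation_mean_def)
  ultimately show ?thesis by (metis theI')
qed

section \<open>Filling a tuple with its mean\<close>

lemma fill_chi:
  assumes "chi \<in> {1..k} \<rightarrow> {1..n}" and "inj_on chi {1..k}" and "j \<in> {1..k}"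
  shows "fill n k chi x y (chi j) = x j"
  using assms by (auto simp: fill_def the_inv_into_f_f)

lemma fill_other: "i \<in> {1..n} \<Longrightarrow> i \<notin> chi ` {1..k} \<Longrightarrow> fill n k chi x y i = y"
  by (simp add: fill_def)

lemma fill_cases:
  assumes "chi \<in> {1..k} \<rightarrow> {1..n}" and "inj_on chi {1..k}" and "i \<in> {1..n}"
  obtains (entry) j where "j \<in> {1..k}" "fill n k chi x y i = x j"
    | (other) "fill n k chi x y i = y"
proof (cases "i \<in> chi ` {1..k}")
  case True
  then obtain j where "j \<in> {1..k}" "i = chi j" by auto
  then show ?thesis using entry[of j] fill_chi[OF assms(1,2), of j x y] by simp
next
  case False
  then show ?thesis using other fill_other[OF assms(3) False, of x y] by simp
qed

lemma fill_in_PiE: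
  assumes "chi \<in> {1..k} \<rightarrow> {1..n}" and "inj_on chi {1..k}"
    and "x \<in> {1..k} \<rightarrow>\<^sub>E D" and "y \<in> D"
  shows "fill n k chi x y \<in> {1..n} \<rightarrow>\<^sub>E D"
proof (rule PiE_I)
  fix i assume "i \<in> {1..n}"
  with assms(1,2) show "fill n k chi x y i \<in> D"
    by (cases rule: fill_cases[where x = x and y = y]) (use assms(3,4) in auto)
qed (auto simp: fill_def)

lemma convex_hull_fill:
  assumes chi: "chi \<in> {1..k} \<rightarrow> {1..n}" "inj_on chi {1..k}"
    and y: "y \<in> convex hull (x ` {1..k})"
  shows "convex hull (fill n k chi x y ` {1..n}) = convex hull (x ` {1..k})"
proof (rule subset_antisym)
  show "convex hull (fill n k chi x y ` {1..n}) \<subseteq> convex hull (x ` {1..k})"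
  proof (intro hull_minimal convex_convex_hull image_subsetI)
    fix i assume "i \<in> {1..n}"
    with chi show "fill n k chi x y i \<in> convex hull (x ` {1..k})"
      by (cases rule: fill_cases[where x = x and y = y]) (use y in \<open>auto intro: hull_inc\<close>)
  qed
  have "x ` {1..k} \<subseteq> fill n k chi x y ` {1..n}"
  proof (rule image_subsetI)
    fix j assume j: "j \<in> {1..k}"
    show "x j \<in> fill n k chi x y ` {1..n}"
      using chi(1) j by (intro rev_image_eqI[of "chi j"]) (auto simp: fill_chi[OF chi j])
  qed
  then show "convex hull (x ` {1..k}) \<subseteq> convex hull (fill n k chi x y ` {1..n})"
    by (rule hull_mono)
qed

lemma sum_deviations_fill:
  assumes E: "\<forall>i\<in>{1..n}. generalized_deviation D (E i)"
    and chi: "chi \<in> {1..k} \<rightarrow> {1..n}" "inj_on chi {1..k}"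
    and "y \<in> D" and h: "h \<in> diff_span D"
  shows "(\<Sum>i\<in>{1..n}. E i (fill n k chi x y i) y h) = (\<Sum>j\<in>{1..k}. E (chi j) (x j) y h)"
proof -
  let ?e = "\<lambda>i. E i (fill n k chi x y i) y h"
  have "(\<Sum>i\<in>{1..n}. ?e i) = (\<Sum>i\<in>chi ` {1..k}. ?e i)"
  proof (rule sum.mono_neutral_right)
    show "\<forall>i\<in>{1..n} - chi ` {1..k}. ?e i = 0"
    proof
      fix i assume i: "i \<in> {1..n} - chi ` {1..k}"
      then have "E i y y = (\<lambda>h\<in>diff_span D. 0)"
        using E \<open>y \<in> D\<close> by (auto simp: generalized_deviation_def)
      then show "?e i = 0" using i h by (simp add: fill_other)
    qed
  qed (use chi(1) in auto)
  also have "\<dots> = (\<Sum>j\<in>{1..k}. ?e (chi j))"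
    using chi(2) by (simp add: sum.reindex)
  finally show ?thesis by (simp add: fill_chi[OF chi])
qed

lemma is_deviation_mean_fill_iff:
  assumes E: "\<forall>i\<in>{1..n}. generalized_deviation D (E i)"
    and chi: "chi \<in> {1..k} \<rightarrow> {1..n}" "inj_on chi {1..k}"
    and x: "x \<in> {1..k} \<rightarrow>\<^sub>E D" and D: "convex D"
    and y: "y \<in> convex hull (x ` {1..k})"
  shows "is_deviation_mean n E (fill n k chi x y) y \<longleftrightarrow>
    is_deviation_mean k (\<lambda>j. E (chi j)) x y"
proof -
  let ?f = "\<lambda>h. \<Sum>j\<in>{1..k}. E (chi j) (x j) y h"
  have "convex hull (x ` {1..k}) \<subseteq> D" using x D by (intro hull_minimal) auto
  then have yD: "y \<in> D" using y by auto
  have "fill n k chi x y i - y \<in> diff_span D" if "i \<in> {1..n}" for i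
    using fill_in_PiE[OF chi x yD] that yD by (intro diff_in_diff_span) auto
  then have sum_eq: "(\<Sum>j\<in>{1..n}. E j (fill n k chi x y j) y (fill n k chi x y i - y)) =
      ?f (fill n k chi x y i - y)" if "i \<in> {1..n}" for i
    using that sum_deviations_fill[OF E chi yD] by blast
  have Ek: "\<forall>j\<in>{1..k}. generalized_deviation D (E (chi j))"
    using E chi(1) by blast
  have "linear_functional_on (diff_span D) ?f"
    using x yD Ek by (intro sum_deviations_linear) auto
  then have f0: "?f 0 = 0"
    using linear_functional_on_zero diff_in_diff_span[OF yD yD] by blast
  have "(\<forall>i\<in>{1..n}. ?f (fill n k chi x y i - y) \<le> 0) \<longleftrightarrow> (\<forall>j\<in>{1..k}. ?f (x j - y) \<le> 0)"
  proof (intro iffI ballI)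
    fix j assume *: "\<forall>i\<in>{1..n}. ?f (fill n k chi x y i - y) \<le> 0" and j: "j \<in> {1..k}"
    have "chi j \<in> {1..n}" using chi(1) j by auto
    with * have "?f (fill n k chi x y (chi j) - y) \<le> 0" by blast
    then show "?f (x j - y) \<le> 0" by (simp add: fill_chi[OF chi j])
  next
    fix i assume *: "\<forall>j\<in>{1..k}. ?f (x j - y) \<le> 0" and i: "i \<in> {1..n}"
    from chi i show "?f (fill n k chi x y i - y) \<le> 0"
      by (cases rule: fill_cases[where x = x and y = y]) (use * f0 in auto)
  qed
  then show ?thesis
    using y sum_eq unfolding is_deviation_mean_def convex_hull_fill[OF chi y] by simp
qed

text \<open>
  If the equation \<open>M ((x|chi)(y)) = y\<close> has exactly one solution in the hull for each \<open>x\<close>, then a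
  reduction is determined on \<open>D\<^sup>k\<close>. The description of \<open>the_reduction\<close> selects among the
  functions that are undefined outside \<open>D\<^sup>k\<close>, whence the restriction in the witness.
\<close>

lemma the_reduction_eqI:
  assumes solution: "\<And>x y. x \<in> {1..k} \<rightarrow>\<^sub>E D \<Longrightarrow>
      y \<in> convex hull (x ` {1..k}) \<and> M (fill n k chi x y) = y \<longleftrightarrow> y = N x"
    and x: "x \<in> {1..k} \<rightarrow>\<^sub>E D"
  shows "is_reduction D n k chi M N" and "the_reduction D n k chi M x = N x"
proof -
  have reduction_iff: "is_reduction D n k chi M K \<longleftrightarrow> (\<forall>x \<in> {1..k} \<rightarrow>\<^sub>E D. K x = N x)" for K
    using solution unfolding is_reduction_def is_mean_def by blast
  then show "is_reduction D n k chi M N" by simp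
  have "the_reduction D n k chi M = restrict N ({1..k} \<rightarrow>\<^sub>E D)"
    unfolding the_reduction_def reduction_iff by (intro the_equality) (auto intro!: extensionalityI)
  then show "the_reduction D n k chi M x = N x" using x by simp
qed

theorem theorem4p6:
  fixes D :: "'a::{real_topological_vector, t2_space} set"
    and n k :: nat
    and E :: "nat \<Rightarrow> 'a \<Rightarrow> 'a \<Rightarrow> 'a \<Rightarrow> real"
    and chi :: "nat \<Rightarrow> nat"
  assumes "D \<noteq> {}" and "convex D"
    and "1 \<le> n" and "k \<in> {1..n}"
    and "\<forall>i\<in>{1..n}. generalized_deviation D (E i)"
    and "chi \<in> {1..k} \<rightarrow> {1..n}" and "inj_on chi {1..k}"
  shows "reducible D n k chi (deviation_mean n E) \<and>
    uniquely_reducible D n k chi (deviation_mean n E) \<and>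
    (\<forall>x \<in> {1..k} \<rightarrow>\<^sub>E D.
       the_reduction D n k chi (deviation_mean n E) x = deviation_mean k (\<lambda>j. E (chi j)) x)"
proof -
  let ?M = "deviation_mean n E" and ?N = "deviation_mean k (\<lambda>j. E (chi j))"
  note D = assms(2) and E = assms(5) and chi = assms(6,7)
  have Ek: "\<forall>j\<in>{1..k}. generalized_deviation D (E (chi j))"
    using E chi(1) by blast
  have M_iff: "?M x = y \<longleftrightarrow> is_deviation_mean n E x y" if "x \<in> {1..n} \<rightarrow>\<^sub>E D" for x y
    using that assms(3) by (intro deviation_mean_eq_iff[OF E _ D]) auto
  have N_iff: "?N x = y \<longleftrightarrow> is_deviation_mean k (\<lambda>j. E (chi j)) x y"
    if "x \<in> {1..k} \<rightarrow>\<^sub>E D" for x y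
    using that assms(4) by (intro deviation_mean_eq_iff[OF Ek _ D]) auto
  have mean: "is_mean D n ?M"
    using M_iff by (auto simp: is_mean_def is_deviation_mean_def)
  have solution: "y \<in> convex hull (x ` {1..k}) \<and> ?M (fill n k chi x y) = y \<longleftrightarrow> y = ?N x"
    if x: "x \<in> {1..k} \<rightarrow>\<^sub>E D" for x y
  proof -
    have "?M (fill n k chi x y) = y \<longleftrightarrow> y = ?N x" if y: "y \<in> convex hull (x ` {1..k})"
    proof -
      have "convex hull (x ` {1..k}) \<subseteq> D" using x D by (intro hull_minimal) auto
      then have "fill n k chi x y \<in> {1..n} \<rightarrow>\<^sub>E D" using fill_in_PiE[OF chi x] y by auto
      then show ?thesis
        using M_iff N_iff[OF x] is_deviation_mean_fill_iff[OF E chi x D y] by metis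
    qed
    moreover have "?N x \<in> convex hull (x ` {1..k})"
      using N_iff[OF x] by (auto simp: is_deviation_mean_def)
    ultimately show ?thesis by blast
  qed
  obtain d where "d \<in> D" using assms(1) by blast
  then have "(\<lambda>i\<in>{1..k}. d) \<in> {1..k} \<rightarrow>\<^sub>E D" by simp
  from the_reduction_eqI(1)[OF solution this] have red: "reducible D n k chi ?M"
    using mean by (auto simp: reducible_def)
  moreover have "uniquely_reducible D n k chi ?M"
    using red solution by (simp add: uniquely_reducible_def)
  moreover have "\<forall>x \<in> {1..k} \<rightarrow>\<^sub>E D. the_reduction D n k chi ?M x = ?N x"
    using the_reduction_eqI(2)[of k D ?M n chi ?N] solution by blast
  ultimately show ?thesis by blast
qed

end
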